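(* Let $d\ge 2$ be an even integer, let $\mathcal{I}_d=\{-\tfrac d2,\ldots,\tfrac d2-1\}$, and let $\mathcal{H}_d$ be a $d$-dimensional Hilbert space with orthonormal basis $\{|j\rangle\}_{j\in\mathcal{I}_d}$. Put $\omega=e^{2\pi i/d}$ and, for real $x$, $\omega^{x}:=e^{2\pi i x/d}$. Define $\hat Q=\sum_{j\in\mathcal{I}_d} j\,|j\rangle\langle j|$, the Fourier basis $\widetilde{|k\rangle}=\frac1{\sqrt d}\sum_{j\in\mathcal{I}_d}\omega^{kj}|j\rangle$ ($k\in\mathcal{I}_d$), and $\hat P=\sum_{k\in\mathcal{I}_d}k\,\widetilde{|k\rangle}\widetilde{\langle k|}$. For $\alpha,\beta\in[0,d)$ let $V_{\alpha\beta}=\omega^{\alpha\hat Q+\beta\hat Q^2}=\sum_j \omega^{\alpha j+\beta j^2}|j\rangle\langle j|$ and $\tilde V_{\alpha\beta}=\omega^{\alpha\hat P+\beta\hat P^2}=\sum_k \omega^{\alpha k+\beta k^2}\widetilde{|k\rangle}\widetilde{\langle k|}$. Let $\mu$ be the distribution on $\mathrm U(d)$ of the random unitary $V_{\alpha''\beta''}\tilde V_{\alpha'\beta'}V_{\alpha\beta}$, where $\alpha,\beta,\alpha',\beta',\alpha'',\beta''$ are independent and uniform on $[0,d)$. Then $\mu$ is an $\varepsilon$-approximate unitary 2-design with $\varepsilon=\frac1d$.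
   Context: For a probability measure $\nu$ on $\mathrm U(d)$, the two-fold twirl is $\mathcal G^{(2)}_\nu(X)=\int U^{\otimes2}X(U^\dagger)^{\otimes 2}\,d\nu(U)$ for $X\in\mathcal L(\mathcal H_d\otimes\mathcal H_d)$; $\mathcal G^{(2)}_{\rm Haar}$ is the twirl with the Haar measure. $\nu$ is an $\varepsilon$-approximate unitary 2-design if $\|\mathcal G^{(2)}_\nu-\mathcal G^{(2)}_{\rm Haar}\|_{2\to2}\le\varepsilon$, where $\|\Phi\|_{2\to2}=\sup_{X\neq0}\|\Phi(X)\|_2/\|X\|_2$ and $\|X\|_2=(\mathrm{Tr}X^\dagger X)^{1/2}$. *)

theory Defs
  imports "HOL-Probability.Probability"
begin

text \<open>Operators on H_d are complex matrices indexed by a finite type 'n with CARD('n) = d;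
  the orthonormal basis vector |j> (j in I_d) is the standard basis vector of the index i
  with lab i = j, for a bijection lab from 'n onto I_d.\<close>

type_synonym 'n op = "complex^'n^'n"

definition cadj :: "complex^('m::finite)^('k::finite) \<Rightarrow> complex^'k^'m" where
  "cadj A = (\<chi> i j. cnj (A $ j $ i))"

definition mtrace :: "complex^('m::finite)^'m \<Rightarrow> complex" where
  "mtrace A = (\<Sum>i\<in>UNIV. A $ i $ i)"

definition unitary_mat :: "complex^('n::finite)^'n \<Rightarrow> bool" where
  "unitary_mat U \<longleftrightarrow> cadj U ** U = mat 1"

definition tens :: "complex^('n::finite)^'n \<Rightarrow> complex^'n^'n \<Rightarrow> complex^('n\<times>'n)^('n\<times>'n)" where
  "tens A B = (\<chi> p q. A $ fst p $ fst q * B $ snd p $ snd q)"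

definition hs_norm :: "complex^('m::finite)^'m \<Rightarrow> real" where
  "hs_norm X = sqrt (Re (mtrace (cadj X ** X)))"

definition norm22 :: "(complex^('m::finite)^'m \<Rightarrow> complex^'m^'m) \<Rightarrow> real" where
  "norm22 \<Phi> = Sup {hs_norm (\<Phi> X) / hs_norm X | X. X \<noteq> 0}"

definition twirl2 :: "(('n::finite) op) measure \<Rightarrow> complex^('n\<times>'n)^('n\<times>'n) \<Rightarrow> complex^('n\<times>'n)^('n\<times>'n)" where
  "twirl2 \<nu> X = (\<integral>U. tens U U ** X ** cadj (tens U U) \<partial>\<nu>)"

definition haar_measure :: "(('n::finite) op) measure \<Rightarrow> bool" where
  "haar_measure M \<longleftrightarrow> prob_space M \<and> sets M = sets borel \<and>
     emeasure M {U. unitary_mat U} = 1 \<and>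
     (\<forall>V. unitary_mat V \<longrightarrow> distr M borel (\<lambda>U. V ** U) = M)"

definition approx_2design :: "(('n::finite) op) measure \<Rightarrow> ('n op) measure \<Rightarrow> real \<Rightarrow> bool" where
  "approx_2design \<nu> H \<epsilon> \<longleftrightarrow> norm22 (\<lambda>X. twirl2 \<nu> X - twirl2 H X) \<le> \<epsilon>"

definition omega_pow :: "('n::finite) itself \<Rightarrow> real \<Rightarrow> complex" where
  "omega_pow _ x = exp (2 * pi * \<i> * complex_of_real x / of_nat CARD('n))"

definition Vmat :: "(('n::finite) \<Rightarrow> int) \<Rightarrow> real \<Rightarrow> real \<Rightarrow> 'n op" where
  "Vmat lab a b = (\<chi> i k. if i = k
      then omega_pow TYPE('n) (a * of_int (lab i) + b * of_int (lab i) ^ 2) else 0)"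

definition fourier_vec :: "(('n::finite) \<Rightarrow> int) \<Rightarrow> 'n \<Rightarrow> complex^'n" where
  "fourier_vec lab k = (\<chi> j. omega_pow TYPE('n) (of_int (lab k * lab j))
      / complex_of_real (sqrt (real CARD('n))))"

definition Vtmat :: "(('n::finite) \<Rightarrow> int) \<Rightarrow> real \<Rightarrow> real \<Rightarrow> 'n op" where
  "Vtmat lab a b = (\<chi> i j. \<Sum>k\<in>UNIV.
      omega_pow TYPE('n) (a * of_int (lab k) + b * of_int (lab k) ^ 2)
      * fourier_vec lab k $ i * cnj (fourier_vec lab k $ j))"

definition rand_unitary :: "(('n::finite) \<Rightarrow> int) \<Rightarrow> (nat \<Rightarrow> real) \<Rightarrow> 'n op" where
  "rand_unitary lab p = Vmat lab (p 4) (p 5) ** Vtmat lab (p 2) (p 3) ** Vmat lab (p 0) (p 1)"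

definition mu :: "(('n::finite) \<Rightarrow> int) \<Rightarrow> ('n op) measure" where
  "mu lab = distr (PiM {..<6} (\<lambda>_. uniform_measure lborel {0..<real CARD('n)}))
                  borel (rand_unitary lab)"

end

theory Submission
  imports Defs
begin

text \<open>
  Averaging conjugation by the diagonal unitaries over both parameters keeps exactly those matrix entries
  \<open>|i,j><k,l|\<close> with \<open>i + j = k + l\<close> and \<open>i\<^sup>2 + j\<^sup>2 = k\<^sup>2 + l\<^sup>2\<close>, that is
  \<open>{i,j} = {k,l}\<close>. This is an orthogonal projection \<open>D\<close>, and the random unitary has twirl \<open>D E D\<close>, where \<open>E\<close>
  is \<open>D\<close> conjugated by the Fourier transform. Let \<open>W\<close> be in the range of \<open>D\<close> and orthogonal to the identity
  and to the swap. Then the resonant entries of \<open>W\<close> in the Fourier basis are character sums in index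
  differences, and Parseval's identity gives \<open>\<parallel>E W\<parallel>\<^sup>2 \<le> \<parallel>W\<parallel>\<^sup>2 / d\<close>. Two such estimates, the second one by
  duality, bound \<open>D E W\<close> by \<open>\<parallel>W\<parallel> / d\<close>.

  Schur-Weyl duality is not needed for the Haar twirl \<open>T\<close>: by left invariance \<open>T X\<close> commutes with all
  \<open>U \<otimes> U\<close>, so it is fixed by \<open>D\<close> and \<open>E\<close>, and \<open>X - T X\<close> is orthogonal to every operator commuting with all
  \<open>U \<otimes> U\<close>. Now take \<open>W = D X - T X\<close>.
\<close>

section \<open>Adjoints and unitary conjugation\<close>

lemma cadj_nth [simp]: "cadj A $ i $ j = cnj (A $ j $ i)"
  by (simp add: cadj_def)

lemma tens_nth [simp]: "tens A B $ p $ q = A $ fst p $ fst q * B $ snd p $ snd q"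
  by (simp add: tens_def)

lemma matrix_mult_nth: "(A ** B) $ i $ j = (\<Sum>k\<in>UNIV. A $ i $ k * B $ k $ j)"
  by (simp add: matrix_matrix_mult_def)

lemma mat_one_nth: "mat 1 $ i $ j = (if i = j then 1 else 0)"
  by (simp add: mat_def)

lemma cadj_cadj [simp]: "cadj (cadj A) = A"
  by (simp add: vec_eq_iff)

lemma cadj_mult: "cadj (A ** B) = cadj B ** cadj A"
  by (simp add: vec_eq_iff matrix_mult_nth mult.commute)

lemma cadj_mat_one [simp]: "cadj (mat 1) = mat 1"
  by (simp add: vec_eq_iff mat_one_nth)

lemma cadj_tens: "cadj (tens A B) = tens (cadj A) (cadj B)"
  by (simp add: vec_eq_iff)

lemma tens_mat_one: "tens (mat 1) (mat 1) = mat 1"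
  by (auto simp: vec_eq_iff mat_one_nth prod_eq_iff)

lemma sum_UNIV_prod:
  "(\<Sum>p\<in>(UNIV :: ('a::finite \<times> 'b::finite) set). f p) = (\<Sum>a\<in>UNIV. \<Sum>b\<in>UNIV. f (a, b))"
  by (simp add: sum.cartesian_product flip: UNIV_Times_UNIV)

lemma tens_mult: "tens A B ** tens A' B' = tens (A ** A') (B ** B')"
  by (simp add: vec_eq_iff matrix_mult_nth sum_UNIV_prod sum_product mult_ac)

lemma unitary_mat_right: "unitary_mat U \<Longrightarrow> U ** cadj U = mat 1"
  by (simp add: unitary_mat_def matrix_left_right_inverse)

lemma unitary_mat_cadj: "unitary_mat U \<Longrightarrow> unitary_mat (cadj U)"
  using unitary_mat_right by (simp add: unitary_mat_def)

lemma unitary_mat_mult: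
  assumes "unitary_mat U" "unitary_mat V"
  shows "unitary_mat (U ** V)"
proof -
  have "cadj (U ** V) ** (U ** V) = cadj V ** (cadj U ** U) ** V"
    by (simp add: cadj_mult matrix_mul_assoc)
  then show ?thesis
    using assms by (simp add: unitary_mat_def)
qed

text \<open>This identifies the Hilbert-Schmidt norm with the Euclidean norm of the nested vector
  type. The inner product is the real one, hence the real part of the trace form.\<close>

lemma inner_eq_mtrace:
  fixes X Y :: "complex^'m::finite^'m"
  shows "inner X Y = Re (mtrace (cadj X ** Y))"
proof -
  have "inner X Y = (\<Sum>j\<in>UNIV. \<Sum>i\<in>UNIV. inner (X $ i $ j) (Y $ i $ j))"
    unfolding inner_vec_def by (rule sum.swap)
  then show ?thesis
    by (simp add: mtrace_def matrix_mult_nth inner_complex_def)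
qed

lemma hs_norm_eq_norm: "hs_norm X = norm X"
  by (simp add: hs_norm_def norm_eq_sqrt_inner inner_eq_mtrace)

lemma mtrace_mult_commute: "mtrace (A ** B) = mtrace (B ** A)"
  unfolding mtrace_def matrix_mult_nth by (subst sum.swap) (simp add: mult.commute)

section \<open>Conjugation by \<open>tens U U\<close>\<close>

definition conj2 :: "('n::finite) op \<Rightarrow> complex^('n\<times>'n)^('n\<times>'n) \<Rightarrow> complex^('n\<times>'n)^('n\<times>'n)"
  where "conj2 U X = tens U U ** X ** cadj (tens U U)"

lemma conj2_mult: "conj2 (U ** V) X = conj2 U (conj2 V X)"
  by (simp add: conj2_def tens_mult [symmetric] cadj_mult matrix_mul_assoc)

lemma conj2_mat_one [simp]: "conj2 (mat 1) X = X"
  by (simp add: conj2_def tens_mat_one)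

lemma conj2_cadj_cancel: "unitary_mat U \<Longrightarrow> conj2 (cadj U) (conj2 U X) = X"
  by (simp add: conj2_mult [symmetric] unitary_mat_def)

text \<open>The trace is cyclic, so the last factor of the conjugation moves round to the other
  argument. For unitary \<open>U\<close> the conjugation is then an isometry.\<close>

lemma inner_conj2_left: "inner (conj2 U X) Y = inner X (conj2 (cadj U) Y)"
proof -
  define C where "C = tens U U"
  have "inner (conj2 U X) Y = Re (mtrace (C ** (cadj X ** cadj C ** Y)))"
    by (simp add: inner_eq_mtrace conj2_def C_def cadj_mult matrix_mul_assoc)
  also have "\<dots> = Re (mtrace (cadj X ** cadj C ** Y ** C))"
    by (subst mtrace_mult_commute) (rule refl)
  also have "\<dots> = inner X (conj2 (cadj U) Y)"
    by (simp add: inner_eq_mtrace conj2_def C_def cadj_tens [symmetric] matrix_mul_assoc)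
  finally show ?thesis .
qed

lemma norm_conj2: "unitary_mat U \<Longrightarrow> norm (conj2 U X) = norm X"
  by (simp add: norm_eq_sqrt_inner inner_conj2_left conj2_cadj_cancel)

lemma conj2_nth_nested:
  "conj2 U X $ p $ q
    = (\<Sum>p'\<in>UNIV. \<Sum>q'\<in>UNIV. tens U U $ p $ p' * cnj (tens U U $ q $ q') * X $ p' $ q')"
proof -
  have "conj2 U X $ p $ q
      = (\<Sum>q'\<in>UNIV. \<Sum>p'\<in>UNIV. tens U U $ p $ p' * cnj (tens U U $ q $ q') * X $ p' $ q')"
    by (simp add: conj2_def matrix_mult_nth sum_distrib_left sum_distrib_right mult_ac del: tens_nth)
  also have "\<dots> = (\<Sum>p'\<in>UNIV. \<Sum>q'\<in>UNIV. tens U U $ p $ p' * cnj (tens U U $ q $ q') * X $ p' $ q')"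
    by (rule sum.swap)
  finally show ?thesis .
qed

text \<open>A single sum over matrix positions \<open>e\<close> makes linearity and continuity
  visible entrywise, and lets \<open>sandwich_nth\<close> attach one weight to each
  position.\<close>

lemma conj2_nth:
  "conj2 U X $ p $ q = (\<Sum>e\<in>UNIV. tens U U $ p $ fst e * cnj (tens U U $ q $ snd e) * X $ fst e $ snd e)"
  unfolding conj2_nth_nested
  by (simp only: sum.cartesian_product case_prod_unfold UNIV_Times_UNIV)

lemma linear_conj2: "linear (conj2 U)"
  by (intro linearI)
     (simp_all add: vec_eq_iff conj2_nth sum.distrib scaleR_sum_right algebra_simps del: tens_nth)

lemma bounded_linear_conj2: "bounded_linear (conj2 U)"
  using linear_conj2 linear_conv_bounded_linear by blast

lemma conj2_diff: "conj2 U (X - Y) = conj2 U X - conj2 U Y"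
  by (rule linear_diff [OF linear_conj2])

section \<open>Invariant operators\<close>

definition invariant2 :: "complex^('n\<times>'n)^(('n::finite)\<times>'n) \<Rightarrow> bool"
  where "invariant2 Y \<longleftrightarrow> (\<forall>U. unitary_mat U \<longrightarrow> conj2 U Y = Y)"

lemma unitary_mat_row:
  assumes "unitary_mat U"
  shows "(\<Sum>k\<in>UNIV. U $ i $ k * cnj (U $ j $ k)) = (if i = j then 1 else 0)"
proof -
  have "(U ** cadj U) $ i $ j = mat 1 $ i $ j"
    using unitary_mat_right [OF assms] by simp
  then show ?thesis
    by (simp add: matrix_mult_nth mat_one_nth)
qed

text \<open>The complex factor \<open>c\<close> matters because \<open>inner\<close> is a real inner
  product: orthogonality to all complex multiples of the swap is what forces a complex trace to
  vanish, see \<open>inner_graph_eq_0_imp\<close>.\<close>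

definition scaled_swap :: "complex \<Rightarrow> complex^('n\<times>'n)^(('n::finite)\<times>'n)"
  where "scaled_swap c = (\<chi> p q. if q = prod.swap p then c else 0)"

definition scaled_id :: "complex \<Rightarrow> complex^('n\<times>'n)^(('n::finite)\<times>'n)"
  where "scaled_id c = (\<chi> p q. if q = p then c else 0)"

text \<open>The sum over \<open>q'\<close> collapses onto the graph of \<open>f\<close>. The
  identity and the swap are the two graphs that occur.\<close>

lemma conj2_graph_nth:
  "conj2 U (\<chi> p q. if q = f p then c else 0) $ p $ q
    = (\<Sum>p'\<in>UNIV. tens U U $ p $ p' * cnj (tens U U $ q $ f p') * c)"
  by (simp add: conj2_nth_nested if_distrib [of "\<lambda>x. _ * x"] del: tens_nth cong: if_cong)

text \<open>After the collapse the double sum factors into two row products of \<open>U\<close>, one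
  for each tensor factor, and the rows are orthonormal. The swap pairs the rows crosswise in the
  same way.\<close>

lemma invariant2_scaled_id: "invariant2 (scaled_id c)"
proof -
  have "conj2 U (scaled_id c) = scaled_id c" if "unitary_mat U" for U :: "'a op"
  proof (clarsimp simp: vec_eq_iff)
    fix p1 p2 q1 q2
    have "conj2 U (scaled_id c) $ (p1, p2) $ (q1, q2)
        = (\<Sum>a\<in>UNIV. \<Sum>b\<in>UNIV. U $ p1 $ a * U $ p2 $ b * cnj (U $ q1 $ a * U $ q2 $ b) * c)"
      by (simp add: scaled_id_def conj2_graph_nth sum_UNIV_prod)
    also have "\<dots> = (\<Sum>a\<in>UNIV. U $ p1 $ a * cnj (U $ q1 $ a)) * (\<Sum>b\<in>UNIV. U $ p2 $ b * cnj (U $ q2 $ b)) * c"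
      by (subst sum.swap) (simp add: sum_distrib_left sum_distrib_right mult_ac)
    also have "\<dots> = scaled_id c $ (p1, p2) $ (q1, q2)"
      by (auto simp: unitary_mat_row [OF that] scaled_id_def)
    finally show "conj2 U (scaled_id c) $ (p1, p2) $ (q1, q2) = scaled_id c $ (p1, p2) $ (q1, q2)" .
  qed
  then show ?thesis by (simp add: invariant2_def)
qed

lemma invariant2_scaled_swap: "invariant2 (scaled_swap c)"
proof -
  have "conj2 U (scaled_swap c) = scaled_swap c" if "unitary_mat U" for U :: "'a op"
  proof (clarsimp simp: vec_eq_iff)
    fix p1 p2 q1 q2
    have "conj2 U (scaled_swap c) $ (p1, p2) $ (q1, q2)
        = (\<Sum>a\<in>UNIV. \<Sum>b\<in>UNIV. U $ p1 $ a * U $ p2 $ b * cnj (U $ q1 $ b * U $ q2 $ a) * c)"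
      by (simp add: scaled_swap_def conj2_graph_nth sum_UNIV_prod)
    also have "\<dots> = (\<Sum>a\<in>UNIV. U $ p1 $ a * cnj (U $ q2 $ a)) * (\<Sum>b\<in>UNIV. U $ p2 $ b * cnj (U $ q1 $ b)) * c"
      by (subst sum.swap) (simp add: sum_distrib_left sum_distrib_right mult_ac)
    also have "\<dots> = scaled_swap c $ (p1, p2) $ (q1, q2)"
      by (auto simp: unitary_mat_row [OF that] scaled_swap_def)
    finally show "conj2 U (scaled_swap c) $ (p1, p2) $ (q1, q2) = scaled_swap c $ (p1, p2) $ (q1, q2)" .
  qed
  then show ?thesis by (simp add: invariant2_def)
qed

section \<open>Twirls\<close>

lemma twirl2_conj2: "twirl2 M X = (\<integral>U. conj2 U X \<partial>M)"
  by (simp add: twirl2_def conj2_def)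

lemma continuous_on_conj2: "continuous_on UNIV (\<lambda>U. conj2 U X)"
proof -
  have eq: "(\<lambda>U. conj2 U X) = (\<lambda>U. \<chi> p q. conj2 U X $ p $ q)" by simp
  show ?thesis
    by (subst eq) (unfold conj2_nth tens_nth, intro continuous_intros)
qed

lemma borel_measurable_conj2 [measurable]: "(\<lambda>U. conj2 U X) \<in> borel_measurable borel"
  by (rule borel_measurable_continuous_onI [OF continuous_on_conj2])

lemma (in finite_measure) integrable_conj2:
  assumes [measurable]: "R \<in> borel_measurable M" and "AE v in M. unitary_mat (R v)"
  shows "integrable M (\<lambda>v. conj2 (R v) X)"
proof (rule integrable_const_bound)
  show "AE v in M. norm (conj2 (R v) X) \<le> norm X"
    using assms(2) by eventually_elim (simp add: norm_conj2)
  show "(\<lambda>v. conj2 (R v) X) \<in> borel_measurable M"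
    by (rule measurable_compose [OF assms(1) borel_measurable_conj2])
qed

lemma haar_measureD:
  fixes H :: "('n::finite) op measure"
  assumes "haar_measure H"
  shows "prob_space H" "sets H = sets borel" "AE U in H. unitary_mat U"
    and "unitary_mat V \<Longrightarrow> distr H borel (\<lambda>U. V ** U) = H"
proof -
  show "prob_space H" and sets: "sets H = sets borel"
    and "unitary_mat V \<Longrightarrow> distr H borel (\<lambda>U. V ** U) = H"
    using assms by (auto simp: haar_measure_def)
  then interpret prob_space H by simp
  have "emeasure H {U. unitary_mat U} = 1"
    using assms by (simp add: haar_measure_def)
  \<comment> \<open>A set outside the sigma-algebra has \<open>emeasure\<close> 0 by convention, so
    the value 1 already yields measurability.\<close>
  moreover from this have "{U. unitary_mat U} \<in> sets H"
    using emeasure_notin_sets by fastforce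
  ultimately show "AE U in H. unitary_mat U"
    using AE_prob_1 [of "{U. unitary_mat U}"] by (simp add: emeasure_eq_measure)
qed

lemma integrable_conj2_haar:
  assumes "haar_measure H"
  shows "integrable H (\<lambda>U. conj2 U X)"
proof -
  note h = haar_measureD [OF assms]
  interpret prob_space H by (rule h)
  have [measurable]: "(\<lambda>U. U) \<in> borel_measurable H"
    using measurable_ident_sets [OF h(2)] by simp
  show ?thesis
    using h(3) by (intro integrable_conj2) auto
qed

text \<open>Conjugation by \<open>V\<close> passes under the integral and turns \<open>U\<close>
  into \<open>V ** U\<close>, which left invariance absorbs.\<close>

lemma invariant2_twirl2_haar:
  fixes H :: "('n::finite) op measure"
  assumes "haar_measure H"
  shows "invariant2 (twirl2 H X)"
  unfolding invariant2_def
proof (intro allI impI)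
  fix V :: "'n op"
  assume V: "unitary_mat V"
  note h = haar_measureD [OF assms]
  have [measurable_cong]: "sets H = sets borel" by (rule h)
  have cont: "continuous_on UNIV (\<lambda>U. V ** U)"
  proof -
    have eq: "(\<lambda>U. V ** U) = (\<lambda>U. \<chi> i j. (V ** U) $ i $ j)" by simp
    show ?thesis
      by (subst eq) (unfold matrix_mult_nth, intro continuous_intros)
  qed
  have [measurable]: "(\<lambda>U. V ** U) \<in> borel_measurable borel"
    by (rule borel_measurable_continuous_onI [OF cont])
  have "conj2 V (twirl2 H X) = (\<integral>U. conj2 V (conj2 U X) \<partial>H)"
    unfolding twirl2_conj2
    by (rule integral_bounded_linear [OF bounded_linear_conj2 integrable_conj2_haar [OF assms], symmetric])
  also have "\<dots> = (\<integral>U. conj2 U X \<partial>distr H borel (\<lambda>U. V ** U))"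
    by (subst integral_distr) (simp_all add: conj2_mult)
  also have "\<dots> = twirl2 H X"
    by (simp add: h(4) [OF V] twirl2_conj2)
  finally show "conj2 V (twirl2 H X) = twirl2 H X" .
qed

text \<open>Moving the conjugation to \<open>Y\<close>, which it fixes, makes the integrand almost
  surely constant. Hence \<open>X - twirl2 H X\<close> is orthogonal to every invariant
  operator.\<close>

lemma inner_twirl2_haar:
  assumes "haar_measure H" and Y: "invariant2 Y"
  shows "inner Y (twirl2 H X) = inner Y X"
proof -
  note h = haar_measureD [OF assms(1)]
  interpret prob_space H by (rule h)
  have "inner Y (twirl2 H X) = (\<integral>U. inner Y (conj2 U X) \<partial>H)"
    unfolding twirl2_conj2
    by (rule integral_bounded_linear [OF bounded_linear_inner_right integrable_conj2_haar [OF assms(1)], symmetric])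
  also have "\<dots> = (\<integral>U. inner Y X \<partial>H)"
  proof (rule integral_cong_AE)
    show "AE U in H. inner Y (conj2 U X) = inner Y X"
      using h(3)
    proof eventually_elim
      case (elim U)
      then have "conj2 (cadj U) Y = Y"
        using Y unitary_mat_cadj by (auto simp: invariant2_def)
      then show ?case
        by (metis inner_commute inner_conj2_left)
    qed
  qed (use integrable_conj2_haar [OF assms(1), of X] in simp_all)
  also have "\<dots> = inner Y X"
    by (simp add: prob_space)
  finally show ?thesis .
qed

section \<open>Resonant entries and characters\<close>

text \<open>This is the Schur (entrywise) product with a weight. Diagonal conjugations and the
  resonant projection are both of this form.\<close>

definition mask :: "(('m::finite) \<times> 'm \<Rightarrow> complex) \<Rightarrow> complex^'m^'m \<Rightarrow> complex^'m^'m"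
  where "mask w X = (\<chi> p q. w (p, q) * X $ p $ q)"

lemma mask_nth [simp]: "mask w X $ p $ q = w (p, q) * X $ p $ q"
  by (simp add: mask_def)

definition resonant :: "('n \<times> 'n) \<times> ('n \<times> 'n) \<Rightarrow> bool"
  where "resonant e \<longleftrightarrow> snd e = fst e \<or> snd e = prod.swap (fst e)"

definition resonant_part :: "complex^('n\<times>'n)^(('n::finite)\<times>'n) \<Rightarrow> complex^('n\<times>'n)^('n\<times>'n)"
  where "resonant_part = mask (\<lambda>e. of_bool (resonant e))"

lemma resonant_part_idem: "resonant_part (resonant_part X) = resonant_part X"
  by (simp add: resonant_part_def vec_eq_iff)

text \<open>The weights are real. Together with \<open>resonant_part_idem\<close> this makes
  \<open>resonant_part\<close> an orthogonal projection.\<close>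

lemma inner_resonant_part: "inner (resonant_part X) Y = inner X (resonant_part Y)"
  unfolding inner_vec_def resonant_part_def by (intro sum.cong refl) auto

lemma resonant_part_diff: "resonant_part (X - Y) = resonant_part X - resonant_part Y"
  by (simp add: resonant_part_def vec_eq_iff algebra_simps)

section \<open>Powers of omega and character sums over the labels\<close>

lemma omega_pow_0 [simp]: "omega_pow T 0 = 1"
  by (simp add: omega_pow_def)

lemma omega_pow_add: "omega_pow T (x + y) = omega_pow T x * omega_pow T y"
  by (simp add: omega_pow_def distrib_left add_divide_distrib exp_add)

lemma cnj_omega_pow: "cnj (omega_pow T x) = omega_pow T (- x)"
  by (simp add: omega_pow_def exp_cnj)

lemma omega_pow_mult_cnj [simp]: "omega_pow T x * cnj (omega_pow T x) = 1"
  unfolding cnj_omega_pow omega_pow_add [symmetric] by simp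

lemma norm_omega_pow [simp]: "norm (omega_pow T x) = 1"
  by (simp add: omega_pow_def)

lemma omega_pow_of_nat_mult: "omega_pow T (of_nat m * x) = omega_pow T x ^ m"
  by (induction m) (simp_all add: omega_pow_add distrib_right)

lemma omega_pow_of_int_eq_1_iff:
  "omega_pow TYPE('n::finite) (of_int r) = 1 \<longleftrightarrow> int CARD('n) dvd r"
proof -
  have "omega_pow TYPE('n) (of_int r) = 1 \<longleftrightarrow> (\<exists>m. 2 * pi * of_int r / real CARD('n) = of_int (2 * m) * pi)"
    by (simp add: omega_pow_def exp_eq_1 Re_divide_of_nat Im_divide_of_nat)
  also have "\<dots> \<longleftrightarrow> (\<exists>m. real_of_int r = real_of_int (int CARD('n) * m))"
    by (intro iff_exI) (auto simp: field_simps)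
  also have "\<dots> \<longleftrightarrow> int CARD('n) dvd r"
    unfolding of_int_eq_iff by (auto simp: dvd_def)
  finally show ?thesis .
qed

text \<open>The value serves as a phase different from 1 that eliminates a nonresonant entry in
  \<open>resonant_part_invariant2\<close>.\<close>

lemma omega_pow_half: "omega_pow TYPE('n::finite) (real CARD('n) / 2) = - 1"
proof -
  have "complex_of_real (2 * pi) * \<i> * complex_of_real (real CARD('n) / 2) / of_nat CARD('n) = \<i> * pi"
    by simp
  then show ?thesis
    unfolding omega_pow_def by (simp only: exp_pi_i')
qed

locale position_labels =
  fixes lab :: "'n::finite \<Rightarrow> int"
  assumes even_card: "even CARD('n)"
    and bij_lab: "bij_betw lab UNIV {- (int CARD('n) div 2) ..< int CARD('n) div 2}"
begin

lemma lab_eq_iff [simp]: "lab i = lab j \<longleftrightarrow> i = j"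
  using bij_lab by (auto simp: bij_betw_def inj_on_def)

text \<open>All labels lie in an interval of \<open>d\<close> consecutive integers, so two of them
  differ by less than \<open>d\<close>.\<close>

lemma lab_cong_imp_eq:
  assumes "int CARD('n) dvd lab i - lab j"
  shows "i = j"
proof -
  have "lab i \<in> {- (int CARD('n) div 2) ..< int CARD('n) div 2}"
    and "lab j \<in> {- (int CARD('n) div 2) ..< int CARD('n) div 2}"
    using bij_lab by (auto simp: bij_betw_def)
  then have "\<bar>lab i - lab j\<bar> < int CARD('n)"
    by auto
  then have "lab i - lab j = 0"
    using assms dvd_imp_le_int [of "lab i - lab j" "int CARD('n)"] by fastforce
  then show ?thesis by simp
qed

lemma character_sum:
  "(\<Sum>k\<in>UNIV. omega_pow TYPE('n) (of_int (r * lab k)))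
    = (if int CARD('n) dvd r then of_nat CARD('n) else 0)"
proof -
  let ?d = "CARD('n)" and ?w = "omega_pow TYPE('n)"
  define h where "h = int ?d div 2"
  \<comment> \<open>As \<open>d\<close> is even, \<open>2 * h = d\<close>, and the shift by
    \<open>h\<close> turns the sum over labels into a geometric sum starting at 0.\<close>
  have bij: "bij_betw (\<lambda>m. int m - h) {..<?d} {- h..<h}"
  proof (rule bij_betw_imageI)
    show "(\<lambda>m. int m - h) ` {..<?d} = {- h..<h}"
    proof (intro equalityI subsetI)
      fix x assume "x \<in> {- h..<h}"
      then have "x = int (nat (x + h)) - h" "nat (x + h) < ?d"
        using even_card by (auto simp: h_def)
      then show "x \<in> (\<lambda>m. int m - h) ` {..<?d}" by blast
    qed (use even_card in \<open>auto simp: h_def\<close>)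
  qed (auto simp: inj_on_def)
  have bij': "bij_betw lab UNIV {- h..<h}"
    using bij_lab by (simp add: h_def)
  have "(\<Sum>k\<in>UNIV. ?w (of_int (r * lab k))) = (\<Sum>x\<in>{- h..<h}. ?w (of_int (r * x)))"
    by (rule sum.reindex_bij_betw [OF bij'])
  also have "\<dots> = (\<Sum>m<?d. ?w (of_int (r * (int m - h))))"
    by (rule sum.reindex_bij_betw [OF bij, symmetric])
  also have "\<dots> = (\<Sum>m<?d. ?w (of_int (- r * h)) * ?w (of_int r) ^ m)"
    by (simp add: omega_pow_of_nat_mult [symmetric] omega_pow_add [symmetric] algebra_simps)
  also have "\<dots> = ?w (of_int (- r * h)) * (\<Sum>m<?d. ?w (of_int r) ^ m)"
    by (rule sum_distrib_left [symmetric])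
  also have "\<dots> = (if int ?d dvd r then of_nat ?d else 0)"
  proof (cases "int ?d dvd r")
    case True
    then show ?thesis
      using omega_pow_of_int_eq_1_iff [where 'n = 'n, of r] omega_pow_of_int_eq_1_iff [where 'n = 'n, of "- r * h"]
      by simp
  next
    case False
    \<comment> \<open>The ratio is a \<open>d\<close>-th root of unity other than 1, so the
      numerator of the geometric sum vanishes.\<close>
    have "?w (of_int r) ^ ?d = ?w (of_int (int ?d * r))"
      by (simp add: omega_pow_of_nat_mult [symmetric])
    also have "\<dots> = 1"
      by (subst omega_pow_of_int_eq_1_iff) simp
    finally show ?thesis
      using False omega_pow_of_int_eq_1_iff [where 'n = 'n, of r] by (simp add: geometric_sum)
  qed
  finally show ?thesis .
qed

section \<open>The Fourier matrix, diagonal phases and resonance\<close>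

definition fourier_mat :: "'n op"
  where "fourier_mat = (\<chi> i k. fourier_vec lab k $ i)"

lemma fourier_mat_nth:
  "fourier_mat $ i $ k = omega_pow TYPE('n) (of_int (lab k * lab i)) / complex_of_real (sqrt (real CARD('n)))"
  by (simp add: fourier_mat_def fourier_vec_def)

lemma sqrt_card_square:
  "complex_of_real (sqrt (real CARD('n))) * complex_of_real (sqrt (real CARD('n))) = of_nat CARD('n)"
  by (simp flip: of_real_mult)

lemma unitary_fourier_mat: "unitary_mat fourier_mat"
proof -
  have "(cadj fourier_mat ** fourier_mat) $ k $ l = mat 1 $ k $ l" for k l
  proof -
    have "(cadj fourier_mat ** fourier_mat) $ k $ l
        = (\<Sum>i\<in>UNIV. omega_pow TYPE('n) (of_int ((lab l - lab k) * lab i)) / of_nat CARD('n))"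
      by (simp add: matrix_mult_nth fourier_mat_nth cnj_omega_pow sqrt_card_square
          omega_pow_add [symmetric] algebra_simps)
    also have "\<dots> = (if int CARD('n) dvd lab l - lab k then 1 else 0)"
      by (simp add: sum_divide_distrib [symmetric] character_sum del: of_int_mult of_int_diff)
    also have "\<dots> = mat 1 $ k $ l"
      using lab_cong_imp_eq [of l k] by (auto simp: mat_one_nth)
    finally show ?thesis .
  qed
  then show ?thesis
    by (simp add: unitary_mat_def vec_eq_iff)
qed

text \<open>For the position of \<open>|i,j><k,l|\<close>, this and \<open>phase_quadratic\<close>
  are the integers multiplying alpha and beta in the phase gained under conjugation by the diagonal
  unitary.\<close>

definition phase_linear :: "('n \<times> 'n) \<times> ('n \<times> 'n) \<Rightarrow> int" where
  "phase_linear e = lab (fst (fst e)) + lab (snd (fst e)) - lab (fst (snd e)) - lab (snd (snd e))"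

definition phase_quadratic :: "('n \<times> 'n) \<times> ('n \<times> 'n) \<Rightarrow> int" where
  "phase_quadratic e =
    lab (fst (fst e)) ^ 2 + lab (snd (fst e)) ^ 2 - lab (fst (snd e)) ^ 2 - lab (snd (snd e)) ^ 2"

text \<open>Each parameter has its own factor, so that an average over independent parameters splits
  into one-dimensional integrals.\<close>

definition phase :: "real \<Rightarrow> real \<Rightarrow> ('n \<times> 'n) \<times> ('n \<times> 'n) \<Rightarrow> complex" where
  "phase a b e =
    omega_pow TYPE('n) (a * of_int (phase_linear e)) * omega_pow TYPE('n) (b * of_int (phase_quadratic e))"

text \<open>An unordered pair of integers is determined by its sum and its sum of squares. The
  equations are exact and not congruences modulo \<open>d\<close>, which matches averaging over real
  parameters.\<close>

lemma resonant_iff: "resonant e \<longleftrightarrow> phase_linear e = 0 \<and> phase_quadratic e = 0"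
proof -
  obtain i j k l where e: "e = ((i, j), (k, l))"
    by (metis prod.exhaust)
  have "(i = k \<and> j = l) \<or> (i = l \<and> j = k)"
    if s: "lab i + lab j - lab k - lab l = 0" and t: "lab i ^ 2 + lab j ^ 2 - lab k ^ 2 - lab l ^ 2 = 0"
  proof -
    have l: "lab l = lab i + lab j - lab k" using s by simp
    \<comment> \<open>Eliminating \<open>lab l\<close> turns the quadratic equation into twice this
      product.\<close>
    have "(lab i - lab k) * (lab k - lab j) = 0"
      using t unfolding l by (simp add: power2_eq_square algebra_simps)
    then have "i = k \<or> k = j" by simp
    then show ?thesis using s by auto
  qed
  then show ?thesis
    by (auto simp: e resonant_def phase_linear_def phase_quadratic_def)
qed

lemma conj2_Vmat: "conj2 (Vmat lab a b) X = mask (phase a b) X"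
proof (clarsimp simp: vec_eq_iff)
  fix p1 p2 q1 q2
  define v where "v i = omega_pow TYPE('n) (a * of_int (lab i) + b * of_int (lab i) ^ 2)" for i
  have tens: "tens (Vmat lab a b) (Vmat lab a b) $ p $ p' = (if p' = p then v (fst p) * v (snd p) else 0)"
    for p p' by (auto simp: Vmat_def v_def prod_eq_iff)
  have "conj2 (Vmat lab a b) X $ (p1, p2) $ (q1, q2)
      = (v p1 * v p2 * cnj (v q1) * cnj (v q2)) * X $ (p1, p2) $ (q1, q2)"
    unfolding conj2_nth_nested tens
    by (simp add: if_distrib [of cnj] if_distrib [of "\<lambda>x. _ * x"] if_distrib [of "\<lambda>x. x * _"] mult_ac cong: if_cong)
  also have "v p1 * v p2 * cnj (v q1) * cnj (v q2) = phase a b ((p1, p2), (q1, q2))"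
    by (simp add: v_def phase_def phase_linear_def phase_quadratic_def cnj_omega_pow
        omega_pow_add [symmetric] algebra_simps)
  finally show "conj2 (Vmat lab a b) X $ (p1, p2) $ (q1, q2)
      = phase a b ((p1, p2), (q1, q2)) * X $ (p1, p2) $ (q1, q2)" .
qed

lemma unitary_Vmat: "unitary_mat (Vmat lab a b)"
proof -
  have "(cadj (Vmat lab a b) ** Vmat lab a b) $ i $ j = mat 1 $ i $ j" for i j
    by (simp add: matrix_mult_nth Vmat_def mat_one_nth if_distrib [of cnj] if_distrib [of "\<lambda>x. _ * x"]
        if_distrib [of "\<lambda>x. x * _"] mult.commute [of "cnj _"] cong: if_cong)
  then show ?thesis
    by (simp add: unitary_mat_def vec_eq_iff)
qed

lemma Vtmat_eq: "Vtmat lab a b = fourier_mat ** Vmat lab a b ** cadj fourier_mat"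
proof -
  have "(fourier_mat ** Vmat lab a b ** cadj fourier_mat) $ i $ j = Vtmat lab a b $ i $ j" for i j
    by (simp add: matrix_mult_nth Vmat_def Vtmat_def fourier_mat_def if_distrib [of "\<lambda>x. _ * x"] mult_ac cong: if_cong)
  then show ?thesis
    by (simp add: vec_eq_iff)
qed

lemma unitary_rand: "unitary_mat (rand_unitary lab v)"
  unfolding rand_unitary_def Vtmat_eq
  by (intro unitary_mat_mult unitary_Vmat unitary_fourier_mat unitary_mat_cadj)

lemma conj2_rand_unitary:
  "conj2 (rand_unitary lab v) X
    = mask (phase (v 4) (v 5)) (conj2 fourier_mat (mask (phase (v 2) (v 3))
        (conj2 (cadj fourier_mat) (mask (phase (v 0) (v 1)) X))))"
  by (simp add: rand_unitary_def Vtmat_eq conj2_mult conj2_Vmat)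

text \<open>No averaging is involved: for each nonresonant position one diagonal unitary has phase
  -1 there, so invariance equates the entry with its negative.\<close>

lemma resonant_part_invariant2:
  fixes Y :: "complex^('n\<times>'n)^('n\<times>'n)"
  assumes "invariant2 Y"
  shows "resonant_part Y = Y"
proof -
  have "Y $ p $ q = 0" if "\<not> resonant (p, q)" for p q
  proof -
    have "mask (phase a b) Y = Y" for a b
      using assms unitary_Vmat by (simp add: invariant2_def conj2_Vmat [symmetric])
    then have eq: "phase a b (p, q) * Y $ p $ q = Y $ p $ q" for a b
      by (metis mask_nth)
    \<comment> \<open>This parameter brings the exponent to \<open>d / 2\<close>. It may lie outside
      \<open>[0,d)\<close>, but \<open>unitary_Vmat\<close> holds for all real parameters.\<close>
    have half: "omega_pow TYPE('n) (real CARD('n) / (2 * of_int m) * of_int m) = - 1" if "m \<noteq> 0" for m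
      using that omega_pow_half [where 'n = 'n] by simp
    from that consider "phase_linear (p, q) \<noteq> 0" | "phase_quadratic (p, q) \<noteq> 0"
      by (auto simp: resonant_iff)
    then show ?thesis
    proof cases
      case 1
      then show ?thesis
        using eq [of "real CARD('n) / (2 * of_int (phase_linear (p, q)))" 0] half [OF 1]
        by (simp add: phase_def)
    next
      case 2
      then show ?thesis
        using eq [of 0 "real CARD('n) / (2 * of_int (phase_quadratic (p, q)))"] half [OF 2]
        by (simp add: phase_def)
    qed
  qed
  then show ?thesis
    by (auto simp: vec_eq_iff resonant_part_def)
qed

end

section \<open>Overlap of the two resonant subspaces\<close>

text \<open>A row \<open>p\<close> has the resonant columns \<open>p\<close> and
  \<open>prod.swap p\<close>. They coincide when the components of \<open>p\<close> are equal, and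
  the conditional avoids counting that column twice.\<close>

lemma sum_resonant:
  fixes g :: "'n::finite \<times> 'n \<Rightarrow> 'a::semiring_1"
  shows "(\<Sum>q\<in>UNIV. of_bool (resonant (p, q)) * g q)
    = g p + (if fst p = snd p then 0 else g (prod.swap p))"
proof -
  have "(\<Sum>q\<in>UNIV. of_bool (resonant (p, q)) * g q) = (\<Sum>q\<in>{p, prod.swap p}. g q)"
    by (rule sum.mono_neutral_cong_right) (auto simp: resonant_def)
  then show ?thesis
    by (cases p) auto
qed

lemma norm_square_matrix: "norm (X :: complex^'m::finite^'k::finite) ^ 2 = (\<Sum>p\<in>UNIV. \<Sum>q\<in>UNIV. norm (X $ p $ q) ^ 2)"
  by (simp add: power2_norm_eq_inner inner_vec_def)

lemma norm_square_resonant_part: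
  "norm (resonant_part X) ^ 2
    = (\<Sum>p\<in>UNIV. norm (X $ p $ p) ^ 2) + (\<Sum>p\<in>UNIV. if fst p = snd p then 0 else norm (X $ p $ prod.swap p) ^ 2)"
proof -
  have "norm (resonant_part X $ p $ q) ^ 2 = of_bool (resonant (p, q)) * norm (X $ p $ q) ^ 2" for p q
    by (simp add: resonant_part_def)
  then show ?thesis
    by (simp add: norm_square_matrix sum_resonant sum.distrib)
qed

lemma inner_graph_eq_0_imp:
  fixes W :: "complex^'m::finite^'m"
  assumes "\<And>c. inner (\<chi> p q. if q = f p then c else 0) W = 0"
  shows "(\<Sum>p\<in>UNIV. W $ p $ f p) = 0"
proof -
  \<comment> \<open>Taking the multiple \<open>c\<close> to be the sum itself makes the inner
    product equal to its squared modulus.\<close>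
  define c where "c = (\<Sum>p\<in>UNIV. W $ p $ f p)"
  have "inner (\<chi> p q. if q = f p then c else 0) W = (\<Sum>p\<in>UNIV. inner c (W $ p $ f p))"
    by (simp add: inner_vec_def if_distrib [of "\<lambda>x. inner x _"] cong: if_cong)
  also have "\<dots> = inner c c"
    by (simp add: c_def inner_sum_right)
  finally show ?thesis
    using assms by (simp add: c_def)
qed

context position_labels
begin

text \<open>This is the character, up to the factor \<open>1 / d ^ 2\<close>, left over from a
  product of Fourier phases when exactly one of the two index pairs is swapped, see
  \<open>fourier_phases\<close>. It depends only on differences of labels.\<close>

definition chi :: "'n \<times> 'n \<Rightarrow> 'n \<times> 'n \<Rightarrow> complex" where
  "chi k p = omega_pow TYPE('n) (of_int ((lab (fst k) - lab (snd k)) * (lab (snd p) - lab (fst p))))"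

lemma sum_chi:
  "(\<Sum>k\<in>UNIV. chi k p * cnj (chi k q))
    = (if int CARD('n) dvd (lab (snd p) - lab (fst p)) - (lab (snd q) - lab (fst q)) then of_nat CARD('n) ^ 2 else 0)"
proof -
  define r where "r = (lab (snd p) - lab (fst p)) - (lab (snd q) - lab (fst q))"
  have "(\<Sum>k\<in>UNIV. chi k p * cnj (chi k q))
      = (\<Sum>i\<in>UNIV. \<Sum>j\<in>UNIV. omega_pow TYPE('n) (of_int (r * lab i)) * omega_pow TYPE('n) (of_int (- r * lab j)))"
    by (simp add: sum_UNIV_prod chi_def cnj_omega_pow omega_pow_add [symmetric] r_def algebra_simps)
  also have "\<dots> = (\<Sum>i\<in>UNIV. omega_pow TYPE('n) (of_int (r * lab i))) * (\<Sum>j\<in>UNIV. omega_pow TYPE('n) (of_int (- r * lab j)))"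
    by (rule sum_product [symmetric])
  also have "\<dots> = (if int CARD('n) dvd r then of_nat CARD('n) ^ 2 else 0)"
    unfolding character_sum by (simp add: power2_eq_square)
  finally show ?thesis by (simp add: r_def)
qed

text \<open>With the difference fixed modulo \<open>d\<close>, the second component determines the
  first.\<close>

lemma card_same_difference:
  "card {q :: 'n \<times> 'n. int CARD('n) dvd (lab (snd p) - lab (fst p)) - (lab (snd q) - lab (fst q))} \<le> CARD('n)"
    (is "card ?S \<le> _")
proof (rule card_inj_on_le)
  show "inj_on snd ?S"
  proof (rule inj_onI)
    fix q q' assume q: "q \<in> ?S" "q' \<in> ?S" "snd q = snd q'"
    have "int CARD('n) dvd
        ((lab (snd p) - lab (fst p)) - (lab (snd q) - lab (fst q))) -
        ((lab (snd p) - lab (fst p)) - (lab (snd q') - lab (fst q')))"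
      by (rule dvd_diff [OF q(1,2) [unfolded mem_Collect_eq]])
    with q(3) have "int CARD('n) dvd lab (fst q) - lab (fst q')" by simp
    with q(3) show "q = q'" by (simp add: prod_eq_iff lab_cong_imp_eq)
  qed
qed auto

text \<open>Expanding the squares and summing over \<open>k\<close> first leaves
  \<open>d ^ 2\<close> times a form supported on pairs with congruent differences. Each
  \<open>p\<close> has at most \<open>d\<close> partners, which supplies the third factor
  \<open>d\<close>.\<close>

lemma chi_energy_le:
  "(\<Sum>k\<in>UNIV. norm (\<Sum>p\<in>UNIV. f p * chi k p) ^ 2) \<le> real CARD('n) ^ 3 * (\<Sum>p\<in>UNIV. norm (f p) ^ 2)"
proof -
  let ?d = "CARD('n)"
  define R :: "'n \<times> 'n \<Rightarrow> 'n \<times> 'n \<Rightarrow> bool"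
    where "R p q \<longleftrightarrow> int ?d dvd (lab (snd p) - lab (fst p)) - (lab (snd q) - lab (fst q))" for p q
  have R_sym: "R p q \<longleftrightarrow> R q p" for p q
    unfolding R_def by (subst dvd_minus_iff [symmetric]) (simp add: algebra_simps)
  have count: "(\<Sum>q\<in>UNIV. of_bool (R p q)) \<le> real ?d" for p
    using card_same_difference [of p] by (simp add: R_def Collect_neg_eq)
  have "complex_of_real (\<Sum>k\<in>UNIV. norm (\<Sum>p\<in>UNIV. f p * chi k p) ^ 2)
      = (\<Sum>k\<in>UNIV. \<Sum>p\<in>UNIV. \<Sum>q\<in>UNIV. f p * cnj (f q) * (chi k p * cnj (chi k q)))"
    unfolding of_real_sum complex_norm_square by (simp add: sum_product mult_ac)
  also have "\<dots> = (\<Sum>p\<in>UNIV. \<Sum>q\<in>UNIV. \<Sum>k\<in>UNIV. f p * cnj (f q) * (chi k p * cnj (chi k q)))"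
    by (subst sum.swap, rule sum.cong [OF refl], rule sum.swap)
  also have "\<dots> = (\<Sum>p\<in>UNIV. \<Sum>q\<in>UNIV. f p * cnj (f q) * (of_bool (R p q) * of_nat ?d ^ 2))"
    unfolding sum_distrib_left [symmetric] sum_chi R_def by (intro sum.cong refl) simp
  finally have "(\<Sum>k\<in>UNIV. norm (\<Sum>p\<in>UNIV. f p * chi k p) ^ 2)
      = Re (\<Sum>p\<in>UNIV. \<Sum>q\<in>UNIV. f p * cnj (f q) * (of_bool (R p q) * of_nat ?d ^ 2))"
    by (metis Re_complex_of_real)
  also have "\<dots> \<le> norm (\<Sum>p\<in>UNIV. \<Sum>q\<in>UNIV. f p * cnj (f q) * (of_bool (R p q) * of_nat ?d ^ 2))"
    by (rule complex_Re_le_cmod)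
  also have "\<dots> \<le> (\<Sum>p\<in>UNIV. \<Sum>q\<in>UNIV. norm (f p * cnj (f q) * (of_bool (R p q) * of_nat ?d ^ 2)))"
    by (intro order_trans [OF norm_sum] sum_mono) simp
  \<comment> \<open>The products are split by the arithmetic-geometric mean inequality. Since
    \<open>R\<close> is symmetric, the two halves have the same sum.\<close>
  also have "\<dots> \<le> (\<Sum>p\<in>UNIV. \<Sum>q\<in>UNIV. real ?d ^ 2 / 2 * (of_bool (R p q) * norm (f p) ^ 2 + of_bool (R q p) * norm (f q) ^ 2))"
  proof (intro sum_mono)
    fix p q
    have "norm (f p) * norm (f q) \<le> (norm (f p) ^ 2 + norm (f q) ^ 2) / 2"
      using sum_squares_bound [of "norm (f p)" "norm (f q)"] by simp
    then have "real ?d ^ 2 * (norm (f p) * norm (f q)) \<le> real ?d ^ 2 * ((norm (f p) ^ 2 + norm (f q) ^ 2) / 2)"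
      by (rule mult_left_mono) simp
    then show "norm (f p * cnj (f q) * (of_bool (R p q) * of_nat ?d ^ 2))
        \<le> real ?d ^ 2 / 2 * (of_bool (R p q) * norm (f p) ^ 2 + of_bool (R q p) * norm (f q) ^ 2)"
      using R_sym [of p q] by (cases "R p q") (simp_all add: norm_mult norm_power mult_ac)
  qed
  also have "\<dots> = real ?d ^ 2 / 2 * ((\<Sum>p\<in>UNIV. \<Sum>q\<in>UNIV. of_bool (R p q) * norm (f p) ^ 2)
      + (\<Sum>p\<in>UNIV. \<Sum>q\<in>UNIV. of_bool (R q p) * norm (f q) ^ 2))"
    by (simp only: sum_distrib_left sum.distrib distrib_left)
  also have "(\<Sum>p\<in>UNIV. \<Sum>q\<in>UNIV. of_bool (R q p) * norm (f q) ^ 2)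
      = (\<Sum>p\<in>UNIV. \<Sum>q\<in>UNIV. of_bool (R p q) * norm (f p) ^ 2)"
    by (rule sum.swap)
  also have "real ?d ^ 2 / 2 * ((\<Sum>p\<in>UNIV. \<Sum>q\<in>UNIV. of_bool (R p q) * norm (f p) ^ 2)
      + (\<Sum>p\<in>UNIV. \<Sum>q\<in>UNIV. of_bool (R p q) * norm (f p) ^ 2))
      = real ?d ^ 2 * (\<Sum>p\<in>UNIV. (\<Sum>q\<in>UNIV. of_bool (R p q)) * norm (f p) ^ 2)"
    by (simp only: sum_distrib_right) simp
  also have "\<dots> \<le> real ?d ^ 2 * (\<Sum>p\<in>UNIV. real ?d * norm (f p) ^ 2)"
    by (intro mult_left_mono sum_mono mult_right_mono count) auto
  also have "\<dots> = real ?d ^ 3 * (\<Sum>p\<in>UNIV. norm (f p) ^ 2)"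
    by (simp add: sum_distrib_left [symmetric] power3_eq_cube power2_eq_square)
  finally show ?thesis .
qed

lemma tens_cadj_fourier:
  "tens (cadj fourier_mat) (cadj fourier_mat) $ k $ p
    = omega_pow TYPE('n) (- of_int (lab (fst k) * lab (fst p) + lab (snd k) * lab (snd p))) / of_nat CARD('n)"
  by (simp add: fourier_mat_nth cnj_omega_pow sqrt_card_square omega_pow_add [symmetric])

lemma fourier_phases:
  fixes k p :: "'n \<times> 'n"
  defines "t \<equiv> \<lambda>k p. tens (cadj fourier_mat) (cadj fourier_mat) $ k $ p"
  shows "t k p * cnj (t k p) = 1 / of_nat CARD('n) ^ 2"
    and "t k p * cnj (t k (prod.swap p)) = chi k p / of_nat CARD('n) ^ 2"
    and "t k p * cnj (t (prod.swap k) p) = chi k p / of_nat CARD('n) ^ 2"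
    and "t k p * cnj (t (prod.swap k) (prod.swap p)) = 1 / of_nat CARD('n) ^ 2"
  unfolding t_def tens_cadj_fourier chi_def
  by (simp_all add: cnj_omega_pow omega_pow_add [symmetric] power2_eq_square algebra_simps)

lemma conj2_fourier_resonant_nth:
  assumes "resonant_part W = W"
  defines "t \<equiv> \<lambda>k p. tens (cadj fourier_mat) (cadj fourier_mat) $ k $ p"
  shows "conj2 (cadj fourier_mat) W $ k $ l
    = (\<Sum>p\<in>UNIV. t k p * cnj (t l p) * W $ p $ p +
        (if fst p = snd p then 0 else t k p * cnj (t l (prod.swap p)) * W $ p $ prod.swap p))"
proof -
  have "W $ p $ q = of_bool (resonant (p, q)) * W $ p $ q" for p q
  proof -
    have "resonant_part W $ p $ q = W $ p $ q" using assms(1) by simp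
    then show ?thesis by (simp add: resonant_part_def)
  qed
  then have "conj2 (cadj fourier_mat) W $ k $ l
      = (\<Sum>p\<in>UNIV. \<Sum>q\<in>UNIV. t k p * cnj (t l q) * (of_bool (resonant (p, q)) * W $ p $ q))"
    unfolding conj2_nth_nested t_def by (intro sum.cong refl) metis
  also have "\<dots> = (\<Sum>p\<in>UNIV. \<Sum>q\<in>UNIV. of_bool (resonant (p, q)) * (t k p * cnj (t l q) * W $ p $ q))"
    by (simp add: mult_ac)
  finally show ?thesis
    by (simp only: sum_resonant)
qed

text \<open>This is the projection \<open>E\<close>: the resonant projection taken in the Fourier
  basis.\<close>

definition fourier_resonant_part :: "complex^('n\<times>'n)^('n\<times>'n) \<Rightarrow> complex^('n\<times>'n)^('n\<times>'n)" where
  "fourier_resonant_part X = conj2 fourier_mat (resonant_part (conj2 (cadj fourier_mat) X))"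

text \<open>Orthogonality to the multiples of identity and swap cancels the parts of the resonant
  Fourier entries that do not depend on \<open>k\<close>. What remains are \<open>chi\<close> sums
  over \<open>d ^ 2\<close>, so the energy bound \<open>d ^ 3\<close> is divided by
  \<open>d ^ 4\<close>.\<close>

lemma norm_fourier_resonant_part_le:
  assumes W: "resonant_part W = W" and orth: "\<And>Y. invariant2 Y \<Longrightarrow> inner Y W = 0"
  shows "norm (fourier_resonant_part W) ^ 2 \<le> norm W ^ 2 / real CARD('n)"
proof -
  let ?d = "CARD('n)"
  define a where "a p = (if fst p = snd p then 0 else W $ p $ p)" for p
  define b where "b p = (if fst p = snd p then 0 else W $ p $ prod.swap p)" for p
  define Z where "Z = conj2 (cadj fourier_mat) W"
  have tr: "(\<Sum>p\<in>UNIV. W $ p $ p) = 0"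
    using inner_graph_eq_0_imp [of "\<lambda>p. p" W] orth [OF invariant2_scaled_id] by (simp add: scaled_id_def)
  have tr_swap: "(\<Sum>p\<in>UNIV. W $ p $ prod.swap p) = 0"
    using inner_graph_eq_0_imp [of prod.swap W] orth [OF invariant2_scaled_swap] by (simp add: scaled_swap_def)
  have Z_diag: "Z $ k $ k = (\<Sum>p\<in>UNIV. b p * chi k p) / of_nat ?d ^ 2" for k
  proof -
    have "Z $ k $ k = (\<Sum>p\<in>UNIV. (W $ p $ p + b p * chi k p) / of_nat ?d ^ 2)"
      unfolding Z_def conj2_fourier_resonant_nth [OF W] fourier_phases
      by (intro sum.cong refl) (simp add: b_def add_divide_distrib)
    then show ?thesis
      using tr by (simp add: sum_divide_distrib [symmetric] sum.distrib)
  qed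
  have Z_swap: "Z $ k $ prod.swap k = (\<Sum>p\<in>UNIV. a p * chi k p) / of_nat ?d ^ 2" for k
  proof -
    \<comment> \<open>If the components of \<open>p\<close> agree, then \<open>chi k p = 1\<close>
      and \<open>p = prod.swap p\<close>. That entry is charged to the swap trace, and therefore
      \<open>a p\<close> is 0 there.\<close>
    have "Z $ k $ prod.swap k = (\<Sum>p\<in>UNIV. (a p * chi k p + W $ p $ prod.swap p) / of_nat ?d ^ 2)"
      unfolding Z_def conj2_fourier_resonant_nth [OF W] fourier_phases
      by (intro sum.cong refl) (auto simp: a_def add_divide_distrib chi_def prod_eq_iff)
    then show ?thesis
      using tr_swap by (simp add: sum_divide_distrib [symmetric] sum.distrib)
  qed
  have normW: "norm W ^ 2 = (\<Sum>p\<in>UNIV. norm (W $ p $ p) ^ 2) + (\<Sum>p\<in>UNIV. norm (b p) ^ 2)"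
    using norm_square_resonant_part [of W] unfolding W by (simp add: b_def if_distrib [of "\<lambda>x. norm x ^ 2"] cong: if_cong)
  have le: "(\<Sum>p\<in>UNIV. norm (a p) ^ 2) \<le> (\<Sum>p\<in>UNIV. norm (W $ p $ p) ^ 2)"
    by (intro sum_mono) (simp add: a_def)
  have "norm (fourier_resonant_part W) ^ 2 = norm (resonant_part Z) ^ 2"
    by (simp add: fourier_resonant_part_def Z_def norm_conj2 unitary_fourier_mat)
  \<comment> \<open>Admitting \<open>k\<close> with equal components to the second sum only
    increases it and makes the sum over \<open>k\<close> complete, as \<open>chi_energy_le\<close>
    requires.\<close>
  also have "\<dots> \<le> (\<Sum>k\<in>UNIV. norm (Z $ k $ k) ^ 2) + (\<Sum>k\<in>UNIV. norm (Z $ k $ prod.swap k) ^ 2)"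
    unfolding norm_square_resonant_part by (intro add_left_mono sum_mono) simp
  also have "\<dots> = ((\<Sum>k\<in>UNIV. norm (\<Sum>p\<in>UNIV. b p * chi k p) ^ 2) + (\<Sum>k\<in>UNIV. norm (\<Sum>p\<in>UNIV. a p * chi k p) ^ 2)) / real ?d ^ 4"
    by (simp add: Z_diag Z_swap norm_divide norm_power power_divide sum_divide_distrib [symmetric] add_divide_distrib
        flip: power_mult)
  also have "\<dots> \<le> (real ?d ^ 3 * (\<Sum>p\<in>UNIV. norm (b p) ^ 2) + real ?d ^ 3 * (\<Sum>p\<in>UNIV. norm (a p) ^ 2)) / real ?d ^ 4"
    by (intro divide_right_mono add_mono chi_energy_le) simp
  also have "\<dots> = ((\<Sum>p\<in>UNIV. norm (b p) ^ 2) + (\<Sum>p\<in>UNIV. norm (a p) ^ 2)) / real ?d"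
    by (simp add: field_simps eval_nat_numeral)
  also have "\<dots> \<le> norm W ^ 2 / real ?d"
    using le normW by (intro divide_right_mono) auto
  finally show ?thesis .
qed

end

section \<open>The twirl of the random unitary\<close>

text \<open>The parameter runs continuously over a full period, so every nonzero integer frequency
  averages to 0, including the multiples of \<open>d\<close>.\<close>

lemma integral_omega_pow_uniform:
  fixes n :: int
  defines "M \<equiv> uniform_measure lborel {0..<real CARD('n::finite)}"
  shows "(\<integral>x. omega_pow TYPE('n) (x * of_int n) \<partial>M) = of_bool (n = 0)"
proof -
  let ?d = "real CARD('n)"
  have d: "?d > 0" by simp
  interpret prob_space M
    unfolding M_def by (rule prob_space_uniform_measure) simp_all
  show ?thesis
  proof (cases "n = 0")
    case True
    then show ?thesis by (simp add: prob_space)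
  next
    case False
    define c where "c = 2 * pi * \<i> * of_int n / of_nat CARD('n)"
    have c: "c \<noteq> 0" using False by (simp add: c_def)
    have w: "omega_pow TYPE('n) (x * of_int n) = exp (c * of_real x)" for x
      by (simp add: omega_pow_def c_def mult_ac)
    have [measurable]: "(\<lambda>x. exp (c * of_real x)) \<in> borel_measurable borel"
      by (intro borel_measurable_continuous_onI continuous_intros)
    have M: "M = density lborel (\<lambda>x. ennreal (indicator {0..<?d} x / ?d))"
      unfolding M_def uniform_measure_def
      by (intro density_cong) (auto simp: divide_ennreal [symmetric] ennreal_indicator)
    have "(\<integral>x. omega_pow TYPE('n) (x * of_int n) \<partial>M)
        = (\<integral>x. (indicator {0..<?d} x / ?d) *\<^sub>R exp (c * of_real x) \<partial>lborel)"
      unfolding M w by (rule integral_density) (auto simp: indicator_def)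
    \<comment> \<open>Closing the interval changes a null set only and permits the fundamental
      theorem of calculus.\<close>
    also have "\<dots> = (\<integral>x. (1 / ?d) *\<^sub>R (indicator {0..?d} x *\<^sub>R exp (c * of_real x)) \<partial>lborel)"
    proof (rule integral_cong_AE)
      show "AE x in lborel. (indicator {0..<?d} x / ?d) *\<^sub>R exp (c * of_real x)
          = (1 / ?d) *\<^sub>R (indicator {0..?d} x *\<^sub>R exp (c * of_real x))"
        using AE_lborel_singleton [of ?d] by eventually_elim (auto simp: indicator_def)
    qed measurable
    also have "\<dots> = (1 / ?d) *\<^sub>R (\<integral>x. indicator {0..?d} x *\<^sub>R exp (c * of_real x) \<partial>lborel)"
      unfolding scaleR_conv_of_real by (rule integral_mult_right_zero)
    also have "(\<integral>x. indicator {0..?d} x *\<^sub>R exp (c * of_real x) \<partial>lborel)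
        = exp (c * of_real ?d) / c - exp (c * of_real 0) / c"
    proof (rule integral_FTC_atLeastAtMost)
      show "((\<lambda>x. exp (c * of_real x) / c) has_vector_derivative exp (c * of_real x)) (at x within {0..?d})" for x
        using c by (intro has_vector_derivative_real_field) (auto intro!: derivative_eq_intros)
    qed (auto intro!: continuous_intros)
    also have "exp (c * of_real ?d) = omega_pow TYPE('n) (of_int (int CARD('n) * n))"
      by (subst w [symmetric]) simp
    also have "\<dots> = 1"
      by (subst omega_pow_of_int_eq_1_iff) simp
    finally show ?thesis using False by simp
  qed
qed

section \<open>Averaging over the six parameters\<close>

lemma borel_measurable_matrixI:
  fixes R :: "'a \<Rightarrow> complex^'m::finite^'k::finite"
  assumes "\<And>i j. (\<lambda>v. R v $ i $ j) \<in> borel_measurable M"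
  shows "R \<in> borel_measurable M"
  unfolding borel_measurable_euclidean_space [of R] Basis_vec_def
  using assms by (auto simp: inner_axis intro!: borel_measurable_inner)

context position_labels
begin

text \<open>All dependence on the weights is gathered in one product with constant coefficients. The
  same expansion serves for the random phases and for their averages.\<close>

lemma sandwich_nth:
  "mask w3 (conj2 fourier_mat (mask w2 (conj2 (cadj fourier_mat) (mask w1 X)))) $ p $ q
    = (\<Sum>e'\<in>UNIV. \<Sum>e\<in>UNIV.
        (tens fourier_mat fourier_mat $ p $ fst e' * cnj (tens fourier_mat fourier_mat $ q $ snd e') *
         tens (cadj fourier_mat) (cadj fourier_mat) $ fst e' $ fst e *
         cnj (tens (cadj fourier_mat) (cadj fourier_mat) $ snd e' $ snd e) * X $ fst e $ snd e) *
        (w3 (p, q) * w2 e' * w1 e))"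
  unfolding mask_nth conj2_nth sum_distrib_left sum_distrib_right
  by (intro sum.cong refl) (simp only: mult_ac prod.collapse)

lemma twirl2_mu: "twirl2 (mu lab) X = resonant_part (fourier_resonant_part (resonant_part X))"
proof -
  let ?N = "uniform_measure lborel {0..<real CARD('n)}"
  let ?P = "PiM {..<6::nat} (\<lambda>_. ?N)"
  let ?w = "omega_pow TYPE('n)"
  interpret N: prob_space ?N
    by (rule prob_space_uniform_measure) simp_all
  interpret P: finite_product_prob_space "\<lambda>_. ?N" "{..<6::nat}"
    by unfold_locales simp
  have [measurable]: "omega_pow TYPE('n) \<in> borel_measurable borel"
    unfolding omega_pow_def by (intro borel_measurable_continuous_onI continuous_intros) simp
  have [measurable]: "rand_unitary lab \<in> borel_measurable ?P"
  proof (rule borel_measurable_matrixI)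
    fix i j
    have *: "(\<lambda>v. v m) \<in> borel_measurable ?P" if "m < 6" for m :: nat
      using measurable_component_singleton [of m "{..<6}" "\<lambda>_. ?N"] that by (simp cong: measurable_cong_sets)
    note [measurable] = *
    have [measurable]: "(\<lambda>v. Vmat lab (v m) (v m') $ i $ j) \<in> borel_measurable ?P" if "m < 6" "m' < 6" for m m' i j
      using that by (cases "i = j") (simp_all add: Vmat_def)
    show "(\<lambda>v. rand_unitary lab v $ i $ j) \<in> borel_measurable ?P"
      unfolding rand_unitary_def Vtmat_eq matrix_mult_nth by measurable
  qed
  have int: "integrable ?P (\<lambda>v. conj2 (rand_unitary lab v) X)"
    by (intro P.integrable_conj2) (simp_all add: unitary_rand)
  have prod: "(\<integral>v. phase (v 4) (v 5) e3 * phase (v 2) (v 3) e2 * phase (v 0) (v 1) e1 \<partial>?P)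
        = of_bool (resonant e3) * of_bool (resonant e2) * of_bool (resonant e1)" (is ?eq)
    and integrable_prod: "integrable ?P (\<lambda>v. phase (v 4) (v 5) e3 * phase (v 2) (v 3) e2 * phase (v 0) (v 1) e1)"
      (is ?int) for e1 e2 e3
  proof -
    \<comment> \<open>The list follows the order of the parameters \<open>v 0\<close> to
      \<open>v 5\<close>, so the integrand is a product of functions of single independent
      coordinates.\<close>
    define n where "n = (\<lambda>i. [phase_linear e1, phase_quadratic e1, phase_linear e2, phase_quadratic e2,
      phase_linear e3, phase_quadratic e3] ! i)"
    have eq: "phase (v 4) (v 5) e3 * phase (v 2) (v 3) e2 * phase (v 0) (v 1) e1
        = (\<Prod>i<6. ?w (v i * of_int (n i)))" for v
      by (simp add: n_def phase_def lessThan_nat_numeral lessThan_Suc eval_nat_numeral mult_ac)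
    have int1: "integrable ?N (\<lambda>x. ?w (x * of_int (n i)))" for i
      by (rule N.integrable_const_bound [of _ 1]) simp_all
    show ?int
      unfolding eq by (rule P.product_integrable_prod) (simp_all add: int1)
    have "(\<integral>v. (\<Prod>i<6. ?w (v i * of_int (n i))) \<partial>?P) = (\<Prod>i<6. of_bool (n i = 0))"
      by (subst P.product_integral_prod) (simp_all add: int1 integral_omega_pow_uniform)
    also have "\<dots> = of_bool (resonant e3) * of_bool (resonant e2) * of_bool (resonant e1)"
      by (auto simp: n_def resonant_iff lessThan_nat_numeral lessThan_Suc eval_nat_numeral)
    finally show ?eq
      unfolding eq .
  qed
  have "twirl2 (mu lab) X = (\<integral>v. conj2 (rand_unitary lab v) X \<partial>?P)"
    unfolding twirl2_conj2 mu_def by (subst integral_distr) simp_all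
  moreover have "(\<integral>v. conj2 (rand_unitary lab v) X \<partial>?P) $ p $ q
      = resonant_part (fourier_resonant_part (resonant_part X)) $ p $ q" for p q
  proof -
    have "(\<integral>v. conj2 (rand_unitary lab v) X \<partial>?P) $ p $ q
        = (\<integral>v. conj2 (rand_unitary lab v) X $ p $ q \<partial>?P)"
      by (rule integral_bounded_linear [OF bounded_linear_compose [OF bounded_linear_vec_nth bounded_linear_vec_nth] int, symmetric])
    then show ?thesis
      unfolding conj2_rand_unitary fourier_resonant_part_def resonant_part_def sandwich_nth
      by (simp add: prod integrable_prod del: tens_nth One_nat_def)
  qed
  ultimately show ?thesis
    by (simp add: vec_eq_iff)
qed

section \<open>Combining the two orthogonal projections\<close>

lemma inner_fourier_resonant_part: "inner (fourier_resonant_part X) Y = inner X (fourier_resonant_part Y)"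
  by (simp add: fourier_resonant_part_def inner_conj2_left inner_resonant_part)

lemma fourier_resonant_part_idem: "fourier_resonant_part (fourier_resonant_part X) = fourier_resonant_part X"
  by (simp add: fourier_resonant_part_def conj2_cadj_cancel unitary_fourier_mat resonant_part_idem)

lemma fourier_resonant_part_diff:
  "fourier_resonant_part (X - Y) = fourier_resonant_part X - fourier_resonant_part Y"
  by (simp add: fourier_resonant_part_def conj2_diff resonant_part_diff)

lemma fourier_resonant_part_invariant2:
  assumes "invariant2 Y"
  shows "fourier_resonant_part Y = Y"
proof -
  have "conj2 (cadj fourier_mat) Y = Y" "conj2 fourier_mat Y = Y"
    using assms unitary_fourier_mat unitary_mat_cadj by (auto simp: invariant2_def)
  then show ?thesis
    using assms by (simp add: fourier_resonant_part_def resonant_part_invariant2)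
qed

lemma norm_resonant_part_le: "norm (resonant_part X) \<le> norm X"
proof -
  have "norm (resonant_part X) ^ 2 = inner (resonant_part X) X"
    by (metis inner_resonant_part power2_norm_eq_inner resonant_part_idem inner_commute)
  also have "\<dots> \<le> norm (resonant_part X) * norm X"
    by (rule norm_cauchy_schwarz)
  finally show ?thesis
    by (cases "resonant_part X = 0") (simp_all add: power2_eq_square)
qed

text \<open>Each crossing between the two resonant subspaces gains \<open>1 / sqrt d\<close>. The
  second gain comes from applying the one-sided bound to \<open>B\<close> itself.\<close>

lemma norm_resonant_fourier_resonant_part_le:
  assumes W: "resonant_part W = W" and orth: "\<And>Y. invariant2 Y \<Longrightarrow> inner Y W = 0"
  shows "norm (resonant_part (fourier_resonant_part W)) \<le> norm W / real CARD('n)"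
proof -
  let ?d = "real CARD('n)"
  define A where "A = fourier_resonant_part W"
  define B where "B = resonant_part A"
  have sqrt_bound: "norm (fourier_resonant_part Z) \<le> norm Z / sqrt ?d"
    if "resonant_part Z = Z" "\<And>Y. invariant2 Y \<Longrightarrow> inner Y Z = 0" for Z
    using real_le_rsqrt [OF norm_fourier_resonant_part_le [OF that]]
    by (simp add: real_sqrt_divide)
  have A: "norm A \<le> norm W / sqrt ?d"
    unfolding A_def by (rule sqrt_bound [OF W orth])
  \<comment> \<open>Both projections are self-adjoint and fix \<open>Y\<close>, so \<open>B\<close>
    inherits orthogonality from \<open>W\<close>.\<close>
  have orthB: "inner Y B = 0" if Y: "invariant2 Y" for Y
  proof -
    have "inner Y B = inner (fourier_resonant_part (resonant_part Y)) W"
      by (simp add: A_def B_def inner_resonant_part inner_fourier_resonant_part)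
    then show ?thesis
      using Y orth by (simp add: resonant_part_invariant2 fourier_resonant_part_invariant2)
  qed
  have "norm B ^ 2 = inner B A"
    unfolding B_def power2_norm_eq_inner by (metis inner_resonant_part resonant_part_idem inner_commute)
  \<comment> \<open>\<open>A\<close> lies in the range of the self-adjoint projection
    \<open>fourier_resonant_part\<close>, which may therefore be inserted in front of
    \<open>B\<close>.\<close>
  also have "\<dots> = inner (fourier_resonant_part B) A"
    by (simp add: inner_fourier_resonant_part A_def fourier_resonant_part_idem)
  also have "\<dots> \<le> norm (fourier_resonant_part B) * norm A"
    by (rule norm_cauchy_schwarz)
  also have "\<dots> \<le> (norm B / sqrt ?d) * (norm W / sqrt ?d)"
    using A sqrt_bound [of B] orthB by (intro mult_mono) (auto simp: B_def resonant_part_idem)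
  also have "\<dots> = norm B * (norm W / ?d)"
    by simp
  finally show ?thesis
    unfolding A_def [symmetric] B_def [symmetric]
    by (cases "B = 0") (simp_all add: power2_eq_square del: times_divide_eq_right)
qed

lemma norm_twirl2_mu_diff_le:
  assumes H: "haar_measure H"
  shows "norm (twirl2 (mu lab) X - twirl2 H X) \<le> norm X / real CARD('n)"
proof -
  define T where "T = twirl2 H X"
  define W where "W = resonant_part X - T"
  have T: "invariant2 T"
    unfolding T_def by (rule invariant2_twirl2_haar [OF H])
  note T' = resonant_part_invariant2 [OF T] fourier_resonant_part_invariant2 [OF T]
  have orth: "inner Y W = 0" if Y: "invariant2 Y" for Y
    using inner_twirl2_haar [OF H Y, of X] inner_resonant_part [of Y X]
    by (simp add: W_def T_def inner_diff_right resonant_part_invariant2 [OF Y])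
  \<comment> \<open>Since \<open>T\<close> is itself invariant,
    \<open>inner T X = inner T T\<close>, and Pythagoras applies.\<close>
  have "norm (X - T) ^ 2 = norm X ^ 2 - norm T ^ 2"
    using inner_twirl2_haar [OF H T, of X] inner_commute [of X T]
    by (simp add: power2_norm_eq_inner inner_diff_left inner_diff_right T_def)
  then have "norm (X - T) \<le> norm X"
    by (simp add: power2_le_imp_le)
  moreover have "W = resonant_part (X - T)"
    by (simp add: W_def resonant_part_diff T')
  ultimately have "norm W \<le> norm X"
    using norm_resonant_part_le [of "X - T"] by simp
  moreover have "twirl2 (mu lab) X - T = resonant_part (fourier_resonant_part W)"
    by (simp add: twirl2_mu W_def fourier_resonant_part_diff resonant_part_diff T')
  moreover have "norm (resonant_part (fourier_resonant_part W)) \<le> norm W / real CARD('n)"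
    using orth by (intro norm_resonant_fourier_resonant_part_le)
      (simp_all add: W_def resonant_part_diff resonant_part_idem T')
  ultimately show ?thesis
    unfolding T_def by (smt (verit) divide_right_mono of_nat_0_le_iff)
qed

end

theorem theorem1:
  fixes lab :: "'n::finite \<Rightarrow> int" and H :: "('n op) measure"
  assumes "even CARD('n)" and "CARD('n) \<ge> 2"
    and "bij_betw lab UNIV {- (int CARD('n) div 2) ..< int CARD('n) div 2}"
    and "haar_measure H"
  shows "approx_2design (mu lab) H (1 / real CARD('n))"
proof -
  interpret position_labels lab
    using assms(1,3) by unfold_locales
  show ?thesis
    unfolding approx_2design_def norm22_def hs_norm_eq_norm
  proof (rule cSup_least)
    \<comment> \<open>\<open>cSup_least\<close> requires a nonempty set; the identity matrix
      supplies a nonzero \<open>X\<close>.\<close>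
    show "{norm (twirl2 (mu lab) X - twirl2 H X) / norm X |X. X \<noteq> 0} \<noteq> {}"
      using exI [of "\<lambda>X :: complex^('n\<times>'n)^('n\<times>'n). X \<noteq> 0" "mat 1"]
      by (auto simp: vec_eq_iff mat_one_nth)
  next
    fix r
    assume "r \<in> {norm (twirl2 (mu lab) X - twirl2 H X) / norm X |X. X \<noteq> 0}"
    then obtain X where "r = norm (twirl2 (mu lab) X - twirl2 H X) / norm X" "X \<noteq> 0"
      by auto
    then show "r \<le> 1 / real CARD('n)"
      using divide_right_mono [OF norm_twirl2_mu_diff_le [OF assms(4), of X], of "norm X"] by simp
  qed
qed

end
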